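(* Let $K$ be an infinite field, $R=K[x_1,\ldots,x_n]$, and let $$\mathcal{F}=\{F_1,\ldots,F_t\}=\{x_1,\ldots,x_n,L_1,\ldots,L_r\}\subseteq R,\qquad L_i=\sum_{j=1}^n u_{ij}x_j,\ u_{ij}\in K,\ t=n+r,$$ be such that $I_{c,\mathcal{F}}$ is the ideal of a linear star configuration of height $c$ on $\mathcal{F}$ for some $c$. Let $U$ be the $n\times r$ matrix whose entry in row $j$ and column $i$ is $u_{ij}$. Fix $2\le s\le n$. The following conditions are equivalent: (1) Any subset of $\mathcal{F}$ of cardinality $s$ is a regular sequence. (2) For every $1\le h\le\min\{r,s\}$, all the submatrices of $U$ of size $(h+n-s)\times h$ have maximal rank.
   Context: For $1\le c\le\min\{n,t\}$, $I_{c,\mathcal{F}}=\bigcap_{1\le i_1<\cdots<i_c\le t}(F_{i_1},\ldots,F_{i_c})$ is called the ideal of the (linear) star configuration of height $c$ on the set $\mathcal{F}$ of linear forms if every subset of $\mathcal{F}$ of cardinality $c+1$ is a regular sequence. Submatrices are obtained by choosing arbitrary sets of rows and columns. *)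

theory Defs
  imports
    "HOL-Library.Poly_Mapping"
    "HOL-Algebra.Ideal"
    "Jordan_Normal_Form.DL_Rank"
    "Jordan_Normal_Form.DL_Submatrix"
begin

text \<open>Polynomials over a field are finitely supported maps from monomials (themselves finitely
  supported maps from variable indices to exponents) to coefficients. This type has the countably
  many variables \<open>x\<^sub>0, x\<^sub>1, \<dots>\<close>; all ideals are taken in the subring in the first \<open>n\<close> of them,
  so the variable \<open>x\<^sub>j\<close> of the literature is \<open>var (j - 1)\<close>.\<close>

type_synonym 'a mpoly = "(nat \<Rightarrow>\<^sub>0 nat) \<Rightarrow>\<^sub>0 'a"

definition polynomial_ring :: "nat \<Rightarrow> 'a::field mpoly ring" where
  "polynomial_ring n =
    \<lparr>carrier = {p. \<forall>m \<in> Poly_Mapping.keys p. Poly_Mapping.keys m \<subseteq> {..<n}},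
     monoid.mult = (*), one = 1, zero = 0, add = (+)\<rparr>"

definition const :: "'a::field \<Rightarrow> 'a mpoly" where
  "const a = Poly_Mapping.single 0 a"

definition var :: "nat \<Rightarrow> 'a::field mpoly" where
  "var j = Poly_Mapping.single (Poly_Mapping.single j 1) 1"

lemma var_in_carrier: "j < n \<Longrightarrow> var j \<in> carrier (polynomial_ring n)"
  by (auto simp: var_def polynomial_ring_def)

lemma const_in_carrier: "const a \<in> carrier (polynomial_ring n)"
  by (auto simp: const_def polynomial_ring_def)

lemma cring_polynomial_ring: "cring (polynomial_ring n :: 'a::field mpoly ring)"
proof (rule cringI)
  show "abelian_group (polynomial_ring n :: 'a mpoly ring)"
  proof (rule abelian_groupI)
    fix x y :: "'a mpoly"
    assume "x \<in> carrier (polynomial_ring n)" "y \<in> carrier (polynomial_ring n)"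
    then show "x \<oplus>\<^bsub>polynomial_ring n\<^esub> y \<in> carrier (polynomial_ring n)"
      using keys_add[of x y] by (fastforce simp: polynomial_ring_def)
  next
    fix x :: "'a mpoly"
    assume "x \<in> carrier (polynomial_ring n)"
    then show "\<exists>y \<in> carrier (polynomial_ring n).
        y \<oplus>\<^bsub>polynomial_ring n\<^esub> x = \<zero>\<^bsub>polynomial_ring n\<^esub>"
      by (intro bexI[of _ "- x"]) (auto simp: polynomial_ring_def)
  qed (auto simp: polynomial_ring_def add_ac)
next
  show "comm_monoid (polynomial_ring n :: 'a mpoly ring)"
  proof (rule comm_monoidI)
    fix x y :: "'a mpoly"
    assume xy: "x \<in> carrier (polynomial_ring n)" "y \<in> carrier (polynomial_ring n)"
    have "Poly_Mapping.keys m \<subseteq> {..<n}" if m: "m \<in> Poly_Mapping.keys (x * y)" for m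
    proof -
      obtain a b where "m = a + b" "a \<in> Poly_Mapping.keys x" "b \<in> Poly_Mapping.keys y"
        using m keys_mult[of x y] by blast
      then show ?thesis
        using xy keys_add[of a b] by (fastforce simp: polynomial_ring_def)
    qed
    then show "x \<otimes>\<^bsub>polynomial_ring n\<^esub> y \<in> carrier (polynomial_ring n)"
      by (auto simp: polynomial_ring_def)
  qed (auto simp: polynomial_ring_def mult_ac)
qed (auto simp: polynomial_ring_def algebra_simps)

text \<open>\<open>xs ! i\<close> is a nonzerodivisor modulo the ideal generated by its predecessors, and the
  whole sequence generates a proper ideal.\<close>

definition regular_sequence :: "('b, 'c) ring_scheme \<Rightarrow> 'b list \<Rightarrow> bool" where
  "regular_sequence R xs \<longleftrightarrow>
    set xs \<subseteq> carrier R \<and>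
    (\<forall>i < length xs. \<forall>a \<in> carrier R.
      xs ! i \<otimes>\<^bsub>R\<^esub> a \<in> Idl\<^bsub>R\<^esub> (set (take i xs)) \<longrightarrow> a \<in> Idl\<^bsub>R\<^esub> (set (take i xs))) \<and>
    Idl\<^bsub>R\<^esub> (set xs) \<noteq> carrier R"

text \<open>A subset of a family \<open>F 0, F 1, \<dots>\<close> is given by its set \<open>S\<close> of indices. Being unordered, it
  counts as a regular sequence if each of its enumerations is one; for homogeneous forms of
  positive degree the order is well known to be immaterial.\<close>

definition regular_subfamily :: "('b, 'c) ring_scheme \<Rightarrow> (nat \<Rightarrow> 'b) \<Rightarrow> nat set \<Rightarrow> bool" where
  "regular_subfamily R F S \<longleftrightarrow>
    (\<forall>is. distinct is \<and> set is = S \<longrightarrow> regular_sequence R (map F is))"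

definition star_ideal :: "('b, 'c) ring_scheme \<Rightarrow> (nat \<Rightarrow> 'b) \<Rightarrow> nat \<Rightarrow> nat \<Rightarrow> 'b set" where
  "star_ideal R F t c = (\<Inter>S \<in> {S. S \<subseteq> {..<t} \<and> card S = c}. Idl\<^bsub>R\<^esub> (F ` S))"

definition is_star_configuration_ideal ::
    "nat \<Rightarrow> (nat \<Rightarrow> 'a::field mpoly) \<Rightarrow> nat \<Rightarrow> nat \<Rightarrow> 'a mpoly set \<Rightarrow> bool" where
  "is_star_configuration_ideal n F t c J \<longleftrightarrow>
    1 \<le> c \<and> c \<le> min n t \<and>
    J = star_ideal (polynomial_ring n) F t c \<and>
    (\<forall>S \<subseteq> {..<t}. card S = c + 1 \<longrightarrow> regular_subfamily (polynomial_ring n) F S)"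

text \<open>The variables, followed by the linear forms whose coefficient vectors are the columns
  of \<open>U\<close>.\<close>

definition forms :: "'a::field mat \<Rightarrow> nat \<Rightarrow> 'a mpoly" where
  "forms U i =
    (if i < dim_row U then var i
     else (\<Sum>j < dim_row U. const (U $$ (j, i - dim_row U)) * var j))"

definition has_maximal_rank :: "'a::field mat \<Rightarrow> bool" where
  "has_maximal_rank A \<longleftrightarrow> vec_space.rank (dim_row A) A = min (dim_row A) (dim_col A)"

end

theory Submission
  imports Defs
begin

text \<open>Modulo the ideal of finitely many linear forms one can eliminate variables, so the quotient is
  again a domain whose linear part is the quotient by their span. Hence a sequence of linear forms
  is regular iff no member lies in the span of its predecessors, that is, iff it is linearly
  independent. The variables outside a set \<open>I\<close> of indices together with the \<open>L\<^sub>i\<close>, \<open>i \<in> J\<close>, are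
  independent iff the \<open>L\<^sub>i\<close> remain so after deleting those variables, which says that the columns
  of the submatrix of \<open>U\<close> on \<open>I \<times> J\<close> are independent. A family of \<open>s\<close> forms with \<open>h\<close> of them
  among the \<open>L\<^sub>i\<close> corresponds to \<open>card I = h + n - s \<ge> h\<close>, where this is maximal rank.\<close>

section \<open>Constants and substitution homomorphisms\<close>

lemma const_simps [simp]:
  "const 0 = 0" "const 1 = 1" "const (a + b) = const a + const b" "const (a * b) = const a * const b"
  "const (- a) = - const a"
  by (simp_all add: const_def single_add mult_single single_uminus)

lemma const_diff: "const (a - b) = const a - const b"
  by (simp add: const_def single_diff)

lemma poly_mapping_sum_single:
  "p = (\<Sum>m \<in> Poly_Mapping.keys p. Poly_Mapping.single m (Poly_Mapping.lookup p m))"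
proof (rule poly_mapping_eqI)
  fix k
  have "(\<Sum>m \<in> Poly_Mapping.keys p. Poly_Mapping.lookup (Poly_Mapping.single m (Poly_Mapping.lookup p m)) k)
      = (\<Sum>m \<in> Poly_Mapping.keys p. if m = k then Poly_Mapping.lookup p k else 0)"
    by (intro sum.cong) (auto simp: lookup_single when_def)
  also have "\<dots> = Poly_Mapping.lookup p k"
    by (auto simp: in_keys_iff)
  finally show "Poly_Mapping.lookup p k = Poly_Mapping.lookup
      (\<Sum>m \<in> Poly_Mapping.keys p. Poly_Mapping.single m (Poly_Mapping.lookup p m)) k"
    by (simp add: lookup_sum)
qed

definition monomial_subst :: "(nat \<Rightarrow> 'a::field mpoly) \<Rightarrow> (nat \<Rightarrow>\<^sub>0 nat) \<Rightarrow> 'a mpoly" where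
  "monomial_subst \<sigma> m = (\<Prod>j \<in> Poly_Mapping.keys m. \<sigma> j ^ Poly_Mapping.lookup m j)"

definition subst :: "(nat \<Rightarrow> 'a::field mpoly) \<Rightarrow> 'a mpoly \<Rightarrow> 'a mpoly" where
  "subst \<sigma> p =
    (\<Sum>m \<in> Poly_Mapping.keys p. const (Poly_Mapping.lookup p m) * monomial_subst \<sigma> m)"

text \<open>Extra indices contribute powers with exponent 0. Products over different supports can
  thus be compared over one common index set. \<open>subst_superset\<close> serves the same purpose
  for sums, where cancellation may shrink the support of \<open>p + q\<close>.\<close>

lemma monomial_subst_superset:
  "finite T \<Longrightarrow> Poly_Mapping.keys m \<subseteq> T \<Longrightarrow>
    monomial_subst \<sigma> m = (\<Prod>j \<in> T. \<sigma> j ^ Poly_Mapping.lookup m j)"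
  unfolding monomial_subst_def by (rule prod.mono_neutral_left) (auto simp: in_keys_iff)

lemma monomial_subst_add: "monomial_subst \<sigma> (a + b) = monomial_subst \<sigma> a * monomial_subst \<sigma> b"
proof -
  let ?T = "Poly_Mapping.keys a \<union> Poly_Mapping.keys b"
  have "Poly_Mapping.keys (a + b) \<subseteq> ?T"
    by (rule keys_add)
  then show ?thesis
    by (simp add: monomial_subst_superset[of ?T] lookup_add power_add prod.distrib)
qed

lemma subst_superset:
  "finite T \<Longrightarrow> Poly_Mapping.keys p \<subseteq> T \<Longrightarrow>
    subst \<sigma> p = (\<Sum>m \<in> T. const (Poly_Mapping.lookup p m) * monomial_subst \<sigma> m)"
  unfolding subst_def by (rule sum.mono_neutral_left) (auto simp: in_keys_iff)

lemma subst_add: "subst \<sigma> (p + q) = subst \<sigma> p + subst \<sigma> q"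
proof -
  let ?T = "Poly_Mapping.keys p \<union> Poly_Mapping.keys q"
  have "Poly_Mapping.keys (p + q) \<subseteq> ?T"
    by (rule keys_add)
  then show ?thesis
    by (simp add: subst_superset[of ?T] lookup_add distrib_right sum.distrib)
qed

lemma subst_zero [simp]: "subst \<sigma> 0 = 0"
  by (simp add: subst_def)

lemma subst_sum: "subst \<sigma> (sum f A) = (\<Sum>i \<in> A. subst \<sigma> (f i))"
  by (induction A rule: infinite_finite_induct) (auto simp: subst_add)

lemma subst_single: "subst \<sigma> (Poly_Mapping.single m c) = const c * monomial_subst \<sigma> m"
  by (simp add: subst_superset[of "{m}"])

lemma subst_mult: "subst \<sigma> (p * q) = subst \<sigma> p * subst \<sigma> q"
proof -
  let ?t = "\<lambda>p m. Poly_Mapping.single m (Poly_Mapping.lookup p m)"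
  let ?K = "Poly_Mapping.keys"
  \<comment> \<open>Expanding both factors into terms reduces multiplicativity to products of single
    terms, where \<open>mult_single\<close> adds exponents.\<close>
  have "subst \<sigma> (p * q) = subst \<sigma> ((\<Sum>m \<in> ?K p. ?t p m) * (\<Sum>m \<in> ?K q. ?t q m))"
    by (simp flip: poly_mapping_sum_single)
  also have "\<dots> = (\<Sum>m \<in> ?K p. \<Sum>m' \<in> ?K q. subst \<sigma> (?t p m) * subst \<sigma> (?t q m'))"
    by (simp add: sum_product subst_sum mult_single subst_single monomial_subst_add mult_ac)
  also have "\<dots> = subst \<sigma> (\<Sum>m \<in> ?K p. ?t p m) * subst \<sigma> (\<Sum>m \<in> ?K q. ?t q m)"
    by (simp add: sum_product subst_sum)
  finally show ?thesis
    by (simp flip: poly_mapping_sum_single)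
qed

lemma subst_const [simp]: "subst \<sigma> (const c) = const c"
  by (simp add: const_def subst_single monomial_subst_def)

lemma subst_one [simp]: "subst \<sigma> 1 = 1"
  using subst_const[of \<sigma> 1] by simp

lemma subst_var [simp]: "subst \<sigma> (var j) = \<sigma> j"
  by (simp add: var_def subst_single monomial_subst_def)

text \<open>Read from right to left, this displays a polynomial as a sum of constants times products
  of variables, which is the form that \<open>carrier_induct\<close> takes apart.\<close>

lemma subst_id: "subst var p = p"
proof -
  have power: "(var j :: 'a mpoly) ^ k = Poly_Mapping.single (Poly_Mapping.single j k) 1" for j k
    by (induction k) (auto simp: var_def mult_single simp flip: single_add)
  have monomial: "(\<Prod>j \<in> T. (var j :: 'a mpoly) ^ f j) =
      Poly_Mapping.single (\<Sum>j \<in> T. Poly_Mapping.single j (f j)) 1" for T f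
    by (induction T rule: infinite_finite_induct) (auto simp: power mult_single)
  have "monomial_subst var m = (Poly_Mapping.single m 1 :: 'a mpoly)" for m
    by (simp add: monomial_subst_def monomial flip: poly_mapping_sum_single)
  then show ?thesis
    by (simp add: subst_def const_def mult_single flip: poly_mapping_sum_single)
qed

section \<open>The subring in the first \<open>n\<close> variables and its ideals\<close>

lemma carrier_induct [consumes 1, case_names const var add mult]:
  assumes p: "p \<in> carrier (polynomial_ring n)"
    and const: "\<And>c. P (const c)"
    and var: "\<And>j. j < n \<Longrightarrow> P (var j)"
    and add: "\<And>p q. P p \<Longrightarrow> P q \<Longrightarrow> P (p + q)"
    and mult: "\<And>p q. P p \<Longrightarrow> P q \<Longrightarrow> P (p * q)"
  shows "P p"
proof -
  have one: "P 1" and zero: "P 0"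
    using const[of 1] const[of 0] by simp_all
  have power: "P (var j ^ k)" if "j < n" for j k
    by (induction k) (auto intro: mult var that one)
  have prod: "P (\<Prod>j \<in> T. var j ^ f j)" if "T \<subseteq> {..<n}" for T f
    using that by (induction T rule: infinite_finite_induct) (auto intro: one mult power)
  have "P (\<Sum>m \<in> T. const (f m) * monomial_subst var m)"
    if "T \<subseteq> Poly_Mapping.keys p" for T f
    using that
  proof (induction T rule: infinite_finite_induct)
    case (insert m T)
    then have "Poly_Mapping.keys m \<subseteq> {..<n}"
      using p by (auto simp: polynomial_ring_def)
    with insert show ?case
      by (auto intro!: add mult const prod simp: monomial_subst_def)
  qed (auto intro: zero)
  then have "P (subst var p)"
    by (simp add: subst_def)
  then show ?thesis
    by (simp add: subst_id)
qed

lemma polynomial_ring_simps [simp]: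
  "monoid.mult (polynomial_ring n) = (*)" "one (polynomial_ring n) = 1"
  "zero (polynomial_ring n) = 0" "add (polynomial_ring n) = (+)"
  by (simp_all add: polynomial_ring_def)

lemma carrier_closed:
  assumes "p \<in> carrier (polynomial_ring n)" "q \<in> carrier (polynomial_ring n)"
  shows "p + q \<in> carrier (polynomial_ring n)" "p * q \<in> carrier (polynomial_ring n)"
    and "- p \<in> carrier (polynomial_ring n)" "p - q \<in> carrier (polynomial_ring n)"
proof -
  interpret cring "polynomial_ring n :: 'a mpoly ring"
    by (rule cring_polynomial_ring)
  have add: "p + q \<in> carrier (polynomial_ring n)"
    if "q \<in> carrier (polynomial_ring n)" for q
    using a_closed[OF assms(1) that] by simp
  show "p + q \<in> carrier (polynomial_ring n)"
    using add assms(2) .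
  show "p * q \<in> carrier (polynomial_ring n)"
    using m_closed[OF assms] by simp
  show "- p \<in> carrier (polynomial_ring n)"
    using assms by (auto simp: polynomial_ring_def)
  show "p - q \<in> carrier (polynomial_ring n)"
    using add[of "- q"] assms by (auto simp: polynomial_ring_def)
qed

lemma subst_carrier:
  assumes "p \<in> carrier (polynomial_ring n)" "\<And>j. j < n \<Longrightarrow> \<sigma> j \<in> carrier (polynomial_ring n)"
  shows "subst \<sigma> p \<in> carrier (polynomial_ring n)"
  using assms(1) by (induction rule: carrier_induct)
    (auto simp: subst_add subst_mult const_in_carrier assms(2) carrier_closed)

lemma ideal_polynomial_ringI:
  assumes "I \<subseteq> carrier (polynomial_ring n)" "0 \<in> I"
    and add: "\<And>a b. a \<in> I \<Longrightarrow> b \<in> I \<Longrightarrow> a + b \<in> I"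
    and mult: "\<And>a r. a \<in> I \<Longrightarrow> r \<in> carrier (polynomial_ring n) \<Longrightarrow> r * a \<in> I"
  shows "ideal I (polynomial_ring n :: 'a::field mpoly ring)"
proof -
  interpret cring "polynomial_ring n :: 'a mpoly ring"
    by (rule cring_polynomial_ring)
  have uminus: "- a \<in> I" if "a \<in> I" for a
    using mult[OF that const_in_carrier[of "- 1"]] by simp
  \<comment> \<open>Subgroups are phrased with the inverse of the additive monoid, which has to be
    identified with the unary minus of the type.\<close>
  have inv: "inv\<^bsub>add_monoid (polynomial_ring n)\<^esub> a = - a" if "a \<in> I" for a
    using minus_equality[of "- a" a] that uminus assms(1) by (auto simp: a_inv_def)
  show ?thesis
  proof (rule idealI)
    show "subgroup I (add_monoid (polynomial_ring n))"
      by (rule subgroup.intro) (use assms uminus inv in auto)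
  qed (use mult in \<open>auto simp: mult.commute ring_axioms\<close>)
qed

lemma ideal_polynomial_ringD:
  assumes "ideal I (polynomial_ring n :: 'a::field mpoly ring)"
  shows "I \<subseteq> carrier (polynomial_ring n)" "0 \<in> I"
    and "\<And>a b. a \<in> I \<Longrightarrow> b \<in> I \<Longrightarrow> a + b \<in> I"
    and "\<And>a r. a \<in> I \<Longrightarrow> r \<in> carrier (polynomial_ring n) \<Longrightarrow> r * a \<in> I"
    and "\<And>a b. a \<in> I \<Longrightarrow> b \<in> I \<Longrightarrow> a - b \<in> I"
proof -
  interpret ideal I "polynomial_ring n :: 'a mpoly ring"
    by (rule assms)
  show "I \<subseteq> carrier (polynomial_ring n)" "0 \<in> I"
    using a_subset additive_subgroup.zero_closed[OF is_additive_subgroup] by auto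
  show add: "a + b \<in> I" if "a \<in> I" "b \<in> I" for a b
    using additive_subgroup.a_closed[OF is_additive_subgroup that] by simp
  show mult: "r * a \<in> I" if "a \<in> I" "r \<in> carrier (polynomial_ring n)" for a r
    using I_l_closed[OF that] by simp
  show "a - b \<in> I" if "a \<in> I" "b \<in> I" for a b
    using add[OF that(1) mult[OF that(2) const_in_carrier[of "- 1"]]] by simp
qed

lemma Idl_polynomial_ring:
  assumes "X \<subseteq> carrier (polynomial_ring n :: 'a::field mpoly ring)"
  shows "ideal (Idl\<^bsub>polynomial_ring n\<^esub> X) (polynomial_ring n)"
    and "X \<subseteq> Idl\<^bsub>polynomial_ring n\<^esub> X"
    and "\<And>I. ideal I (polynomial_ring n) \<Longrightarrow> X \<subseteq> I \<Longrightarrow> Idl\<^bsub>polynomial_ring n\<^esub> X \<subseteq> I"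
proof -
  interpret cring "polynomial_ring n :: 'a mpoly ring"
    by (rule cring_polynomial_ring)
  show "ideal (Idl\<^bsub>polynomial_ring n\<^esub> X) (polynomial_ring n)"
    and "\<And>I. ideal I (polynomial_ring n) \<Longrightarrow> X \<subseteq> I \<Longrightarrow> Idl\<^bsub>polynomial_ring n\<^esub> X \<subseteq> I"
    using assms by (simp_all add: genideal_ideal genideal_minimal)
  show "X \<subseteq> Idl\<^bsub>polynomial_ring n\<^esub> X"
    using assms by (rule genideal_self)
qed

section \<open>Linear forms as a vector space, and elimination of variables\<close>

interpretation mpoly: vector_space "\<lambda>(c :: 'a::field) p. const c * p"
  by unfold_locales (auto simp: algebra_simps)

definition linear_forms :: "nat \<Rightarrow> 'a::field mpoly set" where
  "linear_forms n = mpoly.span (var ` {..<n})"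

text \<open>The constants lie in the ring, so every ideal is a subspace.\<close>

lemma span_subset_ideal:
  assumes "ideal I (polynomial_ring n)" "X \<subseteq> I"
  shows "mpoly.span X \<subseteq> I"
proof
  fix p assume "p \<in> mpoly.span X"
  then show "p \<in> I"
    by (induction rule: mpoly.span_induct_alt)
      (use assms ideal_polynomial_ringD[OF assms(1)] in \<open>auto simp: const_in_carrier\<close>)
qed

lemma linear_forms_in_carrier: "linear_forms n \<subseteq> carrier (polynomial_ring n :: 'a::field mpoly ring)"
  unfolding linear_forms_def
  \<comment> \<open>The carrier is the unit ideal, so \<open>span_subset_ideal\<close> applies to
    it.\<close>
  by (intro span_subset_ideal ideal_polynomial_ringI)
    (auto simp: var_in_carrier carrier_closed, simp add: polynomial_ring_def)

lemma single_one_eq_iff: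
  "Poly_Mapping.single i (1 :: 'b::zero_neq_one) = Poly_Mapping.single j 1 \<longleftrightarrow> i = j"
proof
  assume "Poly_Mapping.single i (1 :: 'b) = Poly_Mapping.single j 1"
  then have "Poly_Mapping.lookup (Poly_Mapping.single j (1 :: 'b)) i = 1"
    by (metis lookup_single_eq)
  then show "i = j"
    by (simp add: lookup_single when_def split: if_splits)
qed simp

lemma linear_formE:
  assumes "l \<in> linear_forms n"
  obtains c where "l = (\<Sum>j<n. const (c j) * var j)"
proof -
  have "inj_on (var :: nat \<Rightarrow> 'a mpoly) {..<n}"
    by (rule inj_onI) (simp only: var_def single_one_eq_iff)
  then show thesis
    using assms that by (auto simp: linear_forms_def mpoly.span_finite sum.reindex)
qed

lemma coeff_linear_form:
  "j < n \<Longrightarrow> Poly_Mapping.lookup (\<Sum>j<n. const (c j) * var j) (Poly_Mapping.single j 1) = c j"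
  by (simp add: lookup_sum const_def var_def mult_single lookup_single when_def single_one_eq_iff[where 'b = nat, simplified])

lemma linear_form_eq_0_iff: "(\<Sum>j<n. const (c j) * var j) = 0 \<longleftrightarrow> (\<forall>j<n. c j = 0)"
proof
  assume "(\<Sum>j<n. const (c j) * var j) = 0"
  then show "\<forall>j<n. c j = 0"
    using coeff_linear_form[of _ n c] by (metis lookup_zero)
qed simp

text \<open>Modulo \<open>I\<close> the substitution fixes constants and variables; being a ring
  homomorphism, it then fixes everything.\<close>

lemma subst_diff_in_ideal:
  fixes \<sigma> :: "nat \<Rightarrow> 'a::field mpoly"
  assumes I: "ideal I (polynomial_ring n)" and p: "p \<in> carrier (polynomial_ring n)"
    and \<sigma>: "\<And>j. j < n \<Longrightarrow> \<sigma> j - var j \<in> I"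
  shows "subst \<sigma> p - p \<in> I"
proof -
  note I = ideal_polynomial_ringD[OF I]
  have \<sigma>': "\<sigma> j \<in> carrier (polynomial_ring n)" if "j < n" for j
    using carrier_closed(1)[of "\<sigma> j - var j" n "var j"] \<sigma>[OF that] I(1) var_in_carrier[OF that] by auto
  \<comment> \<open>Membership in the ring is carried through the induction because the product case
    multiplies elements of \<open>I\<close> by \<open>q\<close> and by
    \<open>subst \<sigma> p\<close>.\<close>
  from p have "p \<in> carrier (polynomial_ring n) \<and> subst \<sigma> p - p \<in> I"
  proof (induction rule: carrier_induct)
    case (add p q)
    have "subst \<sigma> (p + q) - (p + q) = (subst \<sigma> p - p) + (subst \<sigma> q - q)"
      by (simp add: subst_add)
    with add show ?case
      using I(3) by (simp only: carrier_closed simp_thms)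
  next
    case (mult p q)
    have "subst \<sigma> (p * q) - p * q = subst \<sigma> p * (subst \<sigma> q - q) + q * (subst \<sigma> p - p)"
      by (simp add: subst_mult algebra_simps)
    moreover have "subst \<sigma> p \<in> carrier (polynomial_ring n)"
      using mult \<sigma>' by (auto intro: subst_carrier)
    ultimately show ?case
      using mult by (auto simp: carrier_closed intro!: I(3,4))
  qed (use I(2) \<sigma> in \<open>auto simp: const_in_carrier var_in_carrier\<close>)
  then show ?thesis ..
qed

text \<open>The linear counterpart of \<open>subst_diff_in_ideal\<close>: for linear forms the
  difference lies even in the span, since it is a combination of the differences for the
  variables.\<close>

lemma subst_diff_in_span:
  assumes "l \<in> linear_forms n" "\<And>j. j < n \<Longrightarrow> \<sigma> j - var j \<in> mpoly.span X"
  shows "subst \<sigma> l - l \<in> mpoly.span X"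
proof -
  obtain c where l: "l = (\<Sum>j<n. const (c j) * var j)"
    using assms(1) by (rule linear_formE)
  have "subst \<sigma> l - l = (\<Sum>j<n. const (c j) * (\<sigma> j - var j))"
    by (simp add: l subst_sum subst_mult right_diff_distrib sum_subtractf)
  also have "\<dots> \<in> mpoly.span X"
    using assms(2) by (auto intro!: mpoly.span_sum mpoly.span_scale)
  finally show ?thesis .
qed

text \<open>The equation \<open>l = 0\<close> is solved for a variable x_k with nonzero coefficient
  c_k: x_k is replaced by x_k - l / c_k, which sends \<open>l\<close> to l - c_k (l / c_k) =
  0.\<close>

lemma linear_form_elimination:
  assumes l: "l \<in> linear_forms n" and "l \<noteq> 0"
  obtains \<sigma> where "\<And>j. \<sigma> j - var j \<in> mpoly.span {l}" "subst \<sigma> l = 0"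
proof -
  obtain c where c: "l = (\<Sum>j<n. const (c j) * var j)"
    using l by (rule linear_formE)
  with \<open>l \<noteq> 0\<close> obtain k where k: "k < n" "c k \<noteq> 0"
    by (auto simp: linear_form_eq_0_iff)
  define \<sigma> where "\<sigma> j = (if j = k then var k - const (1 / c k) * l else var j)" for j
  have "subst \<sigma> l = (\<Sum>j<n. const (c j) * \<sigma> j)"
    by (subst c) (simp add: subst_sum subst_mult)
  also have "\<dots> = (\<Sum>j<n. const (c j) * var j - (if j = k then const (c k) * const (1 / c k) * l else 0))"
    by (intro sum.cong) (auto simp: \<sigma>_def right_diff_distrib mult.assoc simp del: const_simps)
  also have "\<dots> = l - const (c k * (1 / c k)) * l"
    using k by (simp add: sum_subtractf c[symmetric] del: times_divide_eq_right)
  also have "\<dots> = 0"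
    using k by simp
  finally have "subst \<sigma> l = 0" .
  moreover have "\<sigma> j - var j \<in> mpoly.span {l}" for j
    using mpoly.span_scale[OF mpoly.span_base[of l "{l}"], of "- (1 / c k)"]
    by (auto simp: \<sigma>_def mpoly.span_zero)
  ultimately show thesis
    using that by blast
qed

text \<open>\<open>\<phi>\<close> presents the quotient by the ideal of \<open>X\<close> as a subring
  of the polynomial ring itself; hence this quotient is a domain.\<close>

lemma linear_ideal_retraction:
  assumes "finite X" "X \<subseteq> linear_forms n"
  obtains \<phi> where "\<And>p q. \<phi> (p + q) = \<phi> p + \<phi> q" "\<And>p q. \<phi> (p * q) = \<phi> p * \<phi> q" "\<phi> 1 = 1"
    and "\<And>p. p \<in> carrier (polynomial_ring n) \<Longrightarrow> \<phi> p - p \<in> Idl\<^bsub>polynomial_ring n\<^esub> X"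
    and "\<And>x. x \<in> X \<Longrightarrow> \<phi> x = 0" "\<And>l. l \<in> linear_forms n \<Longrightarrow> \<phi> l - l \<in> mpoly.span X"
  using assms
proof (induction X arbitrary: thesis rule: finite_induct)
  case empty
  have "0 \<in> Idl\<^bsub>polynomial_ring n\<^esub> ({} :: 'a mpoly set)"
    by (rule ideal_polynomial_ringD(2), rule Idl_polynomial_ring) simp
  then show ?case
    by (intro empty(1)[of id]) simp_all
next
  case (insert l X)
  let ?R = "polynomial_ring n :: 'a mpoly ring" and ?Y = "insert l X"
  from insert.prems have XL: "X \<subseteq> linear_forms n" and l: "l \<in> linear_forms n"
    by auto
  obtain \<phi> where add: "\<And>p q. \<phi> (p + q) = \<phi> p + \<phi> q"
    and mult: "\<And>p q. \<phi> (p * q) = \<phi> p * \<phi> q" and one: "\<phi> 1 = 1"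
    and diff: "\<And>p. p \<in> carrier ?R \<Longrightarrow> \<phi> p - p \<in> Idl\<^bsub>?R\<^esub> X"
    and zero: "\<And>x. x \<in> X \<Longrightarrow> \<phi> x = 0"
    and linear: "\<And>p. p \<in> linear_forms n \<Longrightarrow> \<phi> p - p \<in> mpoly.span X"
    using insert.IH[OF _ XL] by blast
  have carr: "X \<subseteq> carrier ?R" "?Y \<subseteq> carrier ?R"
    using XL l linear_forms_in_carrier by blast+
  note idl = Idl_polynomial_ring[OF carr(2)]
  note idlD = ideal_polynomial_ringD[OF idl(1)]
  have X_Y: "Idl\<^bsub>?R\<^esub> X \<subseteq> Idl\<^bsub>?R\<^esub> ?Y"
    using Idl_polynomial_ring(3)[OF carr(1) idl(1)] idl(2) by blast
  have span_linear: "mpoly.span X \<subseteq> linear_forms n"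
    using XL mpoly.span_mono[of X "linear_forms n"]
    by (simp add: linear_forms_def mpoly.span_span)
  \<comment> \<open>Since \<open>\<phi>\<close> moves linear forms only within the span of
    \<open>X\<close>, the image \<open>\<phi> l\<close> is again a linear form and can be eliminated
    in turn.\<close>
  have \<phi>_linear: "\<phi> p \<in> linear_forms n" if "p \<in> linear_forms n" for p
    using mpoly.span_add[of "\<phi> p - p" _ p] linear[OF that] span_linear that
    by (auto simp: linear_forms_def)
  have \<phi>_l: "\<phi> l \<in> linear_forms n" "\<phi> l \<in> mpoly.span ?Y"
  proof -
    show "\<phi> l \<in> linear_forms n"
      using \<phi>_linear l .
    have "\<phi> l - l \<in> mpoly.span ?Y"
      using linear[OF l] mpoly.span_mono[of X ?Y] by auto
    then show "\<phi> l \<in> mpoly.span ?Y"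
      using mpoly.span_add[OF _ mpoly.span_base[of l ?Y], of "\<phi> l - l"] by simp
  qed
  \<comment> \<open>If \<open>\<phi> l = 0\<close>, then \<open>l\<close> already depends on
    \<open>X\<close> and nothing remains to be eliminated; otherwise a variable of
    \<open>\<phi> l\<close> is eliminated.\<close>
  obtain \<sigma> where \<sigma>: "\<And>j. \<sigma> j - var j \<in> mpoly.span ?Y" "subst \<sigma> (\<phi> l) = 0"
  proof (cases "\<phi> l = 0")
    case True
    then show thesis
      using that[of var] by (simp add: mpoly.span_zero)
  next
    case False
    obtain \<sigma> where "\<And>j. \<sigma> j - var j \<in> mpoly.span {\<phi> l}" "subst \<sigma> (\<phi> l) = 0"
      using linear_form_elimination[OF \<phi>_l(1) False] by blast
    moreover have "mpoly.span {\<phi> l} \<subseteq> mpoly.span ?Y"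
      using mpoly.span_mono[of "{\<phi> l}" "mpoly.span ?Y"] \<phi>_l(2) by (simp add: mpoly.span_span)
    ultimately show thesis
      using that by blast
  qed
  have span_Idl: "mpoly.span ?Y \<subseteq> Idl\<^bsub>?R\<^esub> ?Y"
    by (rule span_subset_ideal[OF idl(1,2)])
  have "subst \<sigma> (\<phi> p) - p \<in> Idl\<^bsub>?R\<^esub> ?Y" if p: "p \<in> carrier ?R" for p
  proof -
    have *: "\<phi> p - p \<in> Idl\<^bsub>?R\<^esub> ?Y"
      using diff[OF p] X_Y by blast
    then have "\<phi> p \<in> carrier ?R"
      using carrier_closed(1)[of "\<phi> p - p" n p] p idlD(1) by auto
    then have "subst \<sigma> (\<phi> p) - \<phi> p \<in> Idl\<^bsub>?R\<^esub> ?Y"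
      using \<sigma>(1) span_Idl by (intro subst_diff_in_ideal[OF idl(1)]) auto
    from idlD(3)[OF this *] show ?thesis
      by simp
  qed
  moreover have "subst \<sigma> (\<phi> p) - p \<in> mpoly.span ?Y" if p: "p \<in> linear_forms n" for p
  proof -
    have "subst \<sigma> (\<phi> p) - \<phi> p \<in> mpoly.span ?Y"
      using \<phi>_linear[OF p] \<sigma>(1) by (rule subst_diff_in_span)
    moreover have "\<phi> p - p \<in> mpoly.span ?Y"
      using linear[OF p] mpoly.span_mono[of X ?Y] by blast
    ultimately show ?thesis
      using mpoly.span_add[of "subst \<sigma> (\<phi> p) - \<phi> p" ?Y "\<phi> p - p"] by simp
  qed
  \<comment> \<open>The new retraction applies \<open>\<phi>\<close> first and
    \<open>\<sigma>\<close> second: \<open>X\<close> is killed by \<open>\<phi>\<close>, and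
    \<open>l\<close> by the choice of \<open>\<sigma>\<close>.\<close>
  ultimately show ?case
    by (intro insert.prems(1)[of "\<lambda>p. subst \<sigma> (\<phi> p)"])
      (auto simp: add mult one zero subst_add subst_mult \<sigma>(2))
qed

section \<open>Regularity of linear forms as linear independence\<close>

lemma linear_ideal_prime:
  fixes X :: "'a::field mpoly set"
  assumes "finite X" "X \<subseteq> linear_forms n"
  shows "1 \<notin> Idl\<^bsub>polynomial_ring n\<^esub> X"
    and "\<And>l a. \<lbrakk>l \<in> linear_forms n; l \<notin> mpoly.span X; a \<in> carrier (polynomial_ring n);
      l * a \<in> Idl\<^bsub>polynomial_ring n\<^esub> X\<rbrakk> \<Longrightarrow> a \<in> Idl\<^bsub>polynomial_ring n\<^esub> X"
proof -
  let ?R = "polynomial_ring n :: 'a mpoly ring"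
  obtain \<phi> where add: "\<And>p q. \<phi> (p + q) = \<phi> p + \<phi> q"
    and mult: "\<And>p q. \<phi> (p * q) = \<phi> p * \<phi> q" and one: "\<phi> 1 = 1"
    and diff: "\<And>p. p \<in> carrier ?R \<Longrightarrow> \<phi> p - p \<in> Idl\<^bsub>?R\<^esub> X"
    and zero: "\<And>x. x \<in> X \<Longrightarrow> \<phi> x = 0"
    and linear: "\<And>p. p \<in> linear_forms n \<Longrightarrow> \<phi> p - p \<in> mpoly.span X"
    using linear_ideal_retraction[OF assms] by blast
  have X: "X \<subseteq> carrier ?R"
    using assms linear_forms_in_carrier by blast
  note idl = Idl_polynomial_ring[OF X]
  note idlD = ideal_polynomial_ringD[OF idl(1)]
  have \<phi>0: "\<phi> 0 = 0"
    using add[of 0 0] by (metis add_0 add_cancel_right_right)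
  \<comment> \<open>The kernel of \<open>\<phi>\<close> is an ideal that contains \<open>X\<close>,
    hence the ideal generated by \<open>X\<close>. Conversely, an element \<open>a\<close> of the
    kernel differs from \<open>\<phi> a = 0\<close> by an element of that ideal.\<close>
  have "ideal {p \<in> carrier ?R. \<phi> p = 0} ?R"
    by (rule ideal_polynomial_ringI)
      (use idlD(1,2) in \<open>auto simp: add mult \<phi>0 carrier_closed\<close>)
  then have "Idl\<^bsub>?R\<^esub> X \<subseteq> {p \<in> carrier ?R. \<phi> p = 0}"
    by (rule idl(3)) (use X zero in auto)
  then have kernel: "\<phi> p = 0" if "p \<in> Idl\<^bsub>?R\<^esub> X" for p
    using that by auto
  show "1 \<notin> Idl\<^bsub>?R\<^esub> X"
    using kernel one by force
  fix l a :: "'a mpoly"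
  assume l: "l \<in> linear_forms n" "l \<notin> mpoly.span X"
    and a: "a \<in> carrier ?R" and la: "l * a \<in> Idl\<^bsub>?R\<^esub> X"
  have "\<phi> l \<noteq> 0"
    using linear[OF l(1)] l(2) mpoly.span_neg[of "- l" X] by auto
  \<comment> \<open>Polynomials over a field have no zero divisors, and
    \<open>\<phi> l * \<phi> a = 0\<close>.\<close>
  then have "\<phi> a = 0"
    using kernel[OF la] by (simp add: mult)
  then show "a \<in> Idl\<^bsub>?R\<^esub> X"
    using idlD(5)[OF idlD(2) diff[OF a]] by simp
qed

text \<open>If a member lies in the span of its predecessors, it multiplies 1 into their ideal,
  although 1 is not in it. If it does not, \<open>linear_ideal_prime\<close> says that it can be
  cancelled modulo that ideal.\<close>

lemma regular_sequence_linear_forms_iff: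
  fixes xs :: "'a::field mpoly list"
  assumes xs: "set xs \<subseteq> linear_forms n"
  shows "regular_sequence (polynomial_ring n) xs \<longleftrightarrow>
    (\<forall>i < length xs. xs ! i \<notin> mpoly.span (set (take i xs)))"
proof -
  let ?R = "polynomial_ring n :: 'a mpoly ring"
  have carr: "set xs \<subseteq> carrier ?R"
    using xs linear_forms_in_carrier by blast
  have one: "1 \<in> carrier ?R"
    using const_in_carrier[of 1 n] by simp
  have sub: "set (take i xs) \<subseteq> set xs" for i
    by (rule set_take_subset)
  note prime = linear_ideal_prime[OF _ order_trans[OF sub xs]]
  have proper: "1 \<notin> Idl\<^bsub>?R\<^esub> (set xs)"
    using linear_ideal_prime(1)[OF _ xs] by simp
  show ?thesis
  proof (intro iffI allI impI notI)
    fix i assume reg: "regular_sequence ?R xs" and i: "i < length xs"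
      and "xs ! i \<in> mpoly.span (set (take i xs))"
    moreover note idl = Idl_polynomial_ring[OF order_trans[OF sub[of i] carr]]
    ultimately have "xs ! i * 1 \<in> Idl\<^bsub>?R\<^esub> (set (take i xs))"
      using span_subset_ideal[OF idl(1,2)] by auto
    with reg i one have "1 \<in> Idl\<^bsub>?R\<^esub> (set (take i xs))"
      by (auto simp: regular_sequence_def)
    then show False
      using prime(1) by simp
  next
    assume *: "\<forall>i < length xs. xs ! i \<notin> mpoly.span (set (take i xs))"
    show "regular_sequence ?R xs"
      unfolding regular_sequence_def
    proof (intro conjI allI impI ballI)
      fix i a assume i: "i < length xs" and a: "a \<in> carrier ?R"
        and xa: "xs ! i \<otimes>\<^bsub>?R\<^esub> a \<in> Idl\<^bsub>?R\<^esub> (set (take i xs))"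
      have "xs ! i \<in> linear_forms n"
        using xs nth_mem[OF i] by blast
      then show "a \<in> Idl\<^bsub>?R\<^esub> (set (take i xs))"
        using prime(2)[of i "xs ! i" a] * i a xa by simp
    qed (use carr proper one in auto)
  qed
qed

text \<open>Appending \<open>x\<close> keeps an independent list independent exactly if
  \<open>x\<close> is outside the span. Distinctness is recorded separately because
  \<open>set xs\<close> forgets repetitions.\<close>

lemma span_take_iff_independent:
  "(\<forall>i < length xs. xs ! i \<notin> mpoly.span (set (take i xs))) \<longleftrightarrow>
    distinct xs \<and> \<not> mpoly.dependent (set xs)"
proof (induction xs rule: rev_induct)
  case (snoc x xs)
  have "(\<forall>i < length (xs @ [x]). (xs @ [x]) ! i \<notin> mpoly.span (set (take i (xs @ [x])))) \<longleftrightarrow>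
      (\<forall>i < length xs. xs ! i \<notin> mpoly.span (set (take i xs))) \<and> x \<notin> mpoly.span (set xs)"
    by (auto simp: less_Suc_eq nth_append)
  then show ?case
    using mpoly.span_base[of x "set xs"] by (auto simp: snoc.IH mpoly.independent_insert)
qed (simp add: mpoly.dependent_explicit)

text \<open>Independence does not depend on the order, so all enumerations of \<open>S\<close>
  behave alike. Indexing the coefficients by \<open>S\<close> rather than by the forms themselves
  makes the condition include injectivity of \<open>F\<close> on \<open>S\<close>.\<close>

lemma regular_subfamily_linear_forms_iff:
  fixes F :: "nat \<Rightarrow> 'a::field mpoly"
  assumes "finite S" "F ` S \<subseteq> linear_forms n"
  shows "regular_subfamily (polynomial_ring n) F S \<longleftrightarrow>
    (\<forall>c. (\<Sum>i \<in> S. const (c i) * F i) = 0 \<longrightarrow> (\<forall>i \<in> S. c i = 0))"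
proof -
  have "regular_sequence (polynomial_ring n) (map F is) \<longleftrightarrow>
      inj_on F S \<and> \<not> mpoly.dependent (F ` S)" if "distinct is" "set is = S" for "is"
    using regular_sequence_linear_forms_iff[of "map F is" n, unfolded span_take_iff_independent]
      that assms(2) by (simp add: distinct_map)
  then have "regular_subfamily (polynomial_ring n) F S \<longleftrightarrow>
      inj_on F S \<and> \<not> mpoly.dependent (F ` S)"
    \<comment> \<open>A finite \<open>S\<close> has an enumeration, so the quantifier over
      enumerations is not vacuous.\<close>
    using finite_distinct_list[OF assms(1)] unfolding regular_subfamily_def by blast
  also have "\<dots> \<longleftrightarrow> (\<forall>c. (\<Sum>i \<in> S. const (c i) * F i) = 0 \<longrightarrow> (\<forall>i \<in> S. c i = 0))"
  proof (intro iffI allI impI)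
    fix c assume ind: "inj_on F S \<and> \<not> mpoly.dependent (F ` S)"
      and c: "(\<Sum>i \<in> S. const (c i) * F i) = 0"
    from ind have "\<forall>v \<in> F ` S. u v = 0" if "(\<Sum>v \<in> F ` S. const (u v) * v) = 0" for u
      using that assms(1) by (auto simp: mpoly.dependent_finite)
    from this[of "\<lambda>v. c (the_inv_into S F v)"] show "\<forall>i \<in> S. c i = 0"
      using ind c by (simp add: sum.reindex the_inv_into_f_f)
  next
    assume *: "\<forall>c. (\<Sum>i \<in> S. const (c i) * F i) = 0 \<longrightarrow> (\<forall>i \<in> S. c i = 0)"
    have inj: "inj_on F S"
    proof (rule inj_onI, rule ccontr)
      fix i j assume ij: "i \<in> S" "j \<in> S" "F i = F j" "i \<noteq> j"
      \<comment> \<open>If two indices give the same form, the coefficients 1 and -1 at these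
        indices give a nontrivial relation.\<close>
      let ?c = "\<lambda>k. (if k = i then 1 else 0) - (if k = j then 1 else (0 :: 'a))"
      have "const (?c k) * F k = (if k = i then F i else 0) - (if k = j then F j else 0)" for k
        by (auto simp: const_diff)
      then have "(\<Sum>k \<in> S. const (?c k) * F k) = F i - F j"
        using ij assms(1) by (simp add: sum_subtractf)
      then have "?c i = 0"
        using *[rule_format, of ?c i, OF _ ij(1)] ij(3) by (simp only: diff_self)
      then show False
        using ij by simp
    qed
    have "\<forall>v \<in> F ` S. u v = 0" if "(\<Sum>v \<in> F ` S. const (u v) * v) = 0" for u
    proof -
      have "(\<Sum>i \<in> S. const (u (F i)) * F i) = 0"
        using that by (simp add: sum.reindex[OF inj])
      from *[THEN spec, THEN mp, OF this] show ?thesis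
        by blast
    qed
    then show "inj_on F S \<and> \<not> mpoly.dependent (F ` S)"
      using inj assms(1) by (auto simp: mpoly.dependent_finite)
  qed
  finally show ?thesis .
qed

section \<open>Relations among the variables and the forms given by \<open>U\<close>\<close>

definition form_coeff :: "'a::field mat \<Rightarrow> nat \<Rightarrow> nat \<Rightarrow> 'a" where
  "form_coeff U i j =
    (if i < dim_row U then if j = i then 1 else 0 else U $$ (j, i - dim_row U))"

lemma forms_eq_sum: "forms U i = (\<Sum>j < dim_row U. const (form_coeff U i j) * var j)"
proof (cases "i < dim_row U")
  case True
  then have "(\<Sum>j < dim_row U. const (form_coeff U i j) * var j) =
      (\<Sum>j < dim_row U. if j = i then var i else 0)"
    by (intro sum.cong) (auto simp: form_coeff_def)
  with True show ?thesis
    by (simp add: forms_def)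
qed (simp add: forms_def form_coeff_def)

lemma forms_in_linear_forms: "forms U i \<in> linear_forms (dim_row U)"
  unfolding forms_eq_sum linear_forms_def
  by (intro mpoly.span_sum mpoly.span_scale mpoly.span_base) auto

lemma const_sum: "const (sum f A) = (\<Sum>i \<in> A. const (f i))"
  by (induction A rule: infinite_finite_induct) auto

text \<open>Comparison of the coefficients of each variable. The \<open>form_coeff U i j\<close> are
  the entries of the block matrix formed by the identity and \<open>U\<close>, so relations are
  kernel vectors of its columns in \<open>S\<close>.\<close>

lemma forms_relation_iff:
  "(\<Sum>i \<in> S. const (c i) * forms U i) = 0 \<longleftrightarrow>
    (\<forall>j < dim_row U. (\<Sum>i \<in> S. c i * form_coeff U i j) = 0)"
proof -
  have "(\<Sum>i \<in> S. const (c i) * forms U i) =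
      (\<Sum>j < dim_row U. const (\<Sum>i \<in> S. c i * form_coeff U i j) * var j)"
    unfolding forms_eq_sum const_sum sum_distrib_left sum_distrib_right
    by (subst sum.swap) (simp add: mult_ac)
  then show ?thesis
    by (simp add: linear_form_eq_0_iff)
qed

text \<open>A row \<open>j\<close> in \<open>A\<close> only determines the coefficient of x_j from
  those of the forms in \<open>J\<close>. The remaining rows involve the latter alone and are the
  actual constraints.\<close>

lemma regular_subfamily_forms_iff:
  assumes U: "U \<in> carrier_mat n r" and A: "A \<subseteq> {..<n}" and J: "finite J"
  shows "regular_subfamily (polynomial_ring n) (forms U) (A \<union> (+) n ` J) \<longleftrightarrow>
    (\<forall>d. (\<forall>j \<in> {..<n} - A. (\<Sum>i \<in> J. d i * U $$ (j, i)) = 0) \<longrightarrow> (\<forall>i \<in> J. d i = 0))"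
    (is "?L = ?R")
proof -
  let ?S = "A \<union> (+) n ` J"
  have finA: "finite A"
    using A finite_subset by blast
  have coeff: "(\<Sum>i \<in> ?S. c i * form_coeff U i j) =
      (if j \<in> A then c j else 0) + (\<Sum>i \<in> J. c (n + i) * U $$ (j, i))" for c j
  proof -
    have "(\<Sum>i \<in> ?S. c i * form_coeff U i j) =
        (\<Sum>i \<in> A. c i * form_coeff U i j) + (\<Sum>i \<in> (+) n ` J. c i * form_coeff U i j)"
      using A J finA by (intro sum.union_disjoint) auto
    moreover have "(\<Sum>i \<in> A. c i * form_coeff U i j) = (\<Sum>i \<in> A. if i = j then c j else 0)"
      using A U by (intro sum.cong) (auto simp: form_coeff_def)
    moreover have "(\<Sum>i \<in> (+) n ` J. c i * form_coeff U i j) = (\<Sum>i \<in> J. c (n + i) * U $$ (j, i))"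
      using U by (simp add: sum.reindex form_coeff_def)
    ultimately show ?thesis
      using finA by simp
  qed
  have "?L \<longleftrightarrow> (\<forall>c. (\<forall>j < n. (if j \<in> A then c j else 0) + (\<Sum>i \<in> J. c (n + i) * U $$ (j, i)) = 0)
      \<longrightarrow> (\<forall>i \<in> ?S. c i = 0))"
    using regular_subfamily_linear_forms_iff[of ?S "forms U" n] U J finA forms_in_linear_forms[of U]
    by (simp add: image_subset_iff forms_relation_iff coeff)
  also have "\<dots> \<longleftrightarrow> ?R"
  proof (intro iffI allI impI)
    fix d
    assume *: "\<forall>c. (\<forall>j < n. (if j \<in> A then c j else 0) + (\<Sum>i \<in> J. c (n + i) * U $$ (j, i)) = 0)
      \<longrightarrow> (\<forall>i \<in> ?S. c i = 0)"
      and d: "\<forall>j \<in> {..<n} - A. (\<Sum>i \<in> J. d i * U $$ (j, i)) = 0"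
    \<comment> \<open>The variables in \<open>A\<close> absorb the entries of the relation that \<open>d\<close> leaves open.\<close>
    let ?c = "\<lambda>i. if i < n then - (\<Sum>k \<in> J. d k * U $$ (i, k)) else d (i - n)"
    have "\<forall>i \<in> ?S. ?c i = 0"
      using d by (intro *[rule_format, of ?c, THEN ballI]) auto
    then have "?c (n + i) = 0" if "i \<in> J" for i
      using that by blast
    then show "\<forall>i \<in> J. d i = 0"
      by simp
  next
    fix c
    assume *: ?R
      and c: "\<forall>j < n. (if j \<in> A then c j else 0) + (\<Sum>i \<in> J. c (n + i) * U $$ (j, i)) = 0"
    have "(\<Sum>i \<in> J. c (n + i) * U $$ (j, i)) = 0" if "j \<in> {..<n} - A" for j
      using c that by (auto dest: spec[of _ j])
    then have J0: "\<forall>i \<in> J. c (n + i) = 0"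
      using *[rule_format, of "\<lambda>i. c (n + i)"] by blast
    \<comment> \<open>Once the coefficients over \<open>J\<close> vanish, row \<open>j\<close> reads
      \<open>c j = 0\<close>.\<close>
    have "c j = 0" if "j \<in> A" for j
      using c[rule_format, of j] that A J0 by auto
    with J0 show "\<forall>i \<in> ?S. c i = 0"
      by auto
  qed
  finally show ?thesis .
qed

section \<open>Maximal rank of submatrices as triviality of a kernel\<close>

lemma (in vec_space) rank_eq_dim_col_iff:
  assumes A: "A \<in> carrier_mat n nc"
  shows "rank A = nc \<longleftrightarrow> (\<forall>v \<in> carrier_vec nc. A *\<^sub>v v = 0\<^sub>v n \<longrightarrow> v = 0\<^sub>v nc)"
proof
  assume rank: "rank A = nc"
  \<comment> \<open>The rank is the size of a maximal independent set of columns. A repeated column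
    would leave fewer than \<open>nc\<close> elements to choose from.\<close>
  have "distinct (cols A)"
  proof (rule ccontr)
    assume "\<not> distinct (cols A)"
    then have less: "card (set (cols A)) < nc"
      using A card_distinct[of "cols A"] card_length[of "cols A"] by fastforce
    obtain S where S: "maximal S (\<lambda>T. T \<subseteq> set (cols A) \<and> lin_indpt T)"
      using maximal_exists_superset[of "set (cols A)" "\<lambda>T. T \<subseteq> set (cols A) \<and> lin_indpt T" "{}"]
      by (auto simp: finite_lin_indpt2)
    then have "card S \<le> card (set (cols A))"
      by (simp add: card_mono maximal_def)
    then show False
      using rank_card_indpt[OF A S] rank less by simp
  qed
  with full_rank_lin_indpt[OF A rank] lin_depI[OF A]
  show "\<forall>v \<in> carrier_vec nc. A *\<^sub>v v = 0\<^sub>v n \<longrightarrow> v = 0\<^sub>v nc"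
    by blast
next
  assume kernel: "\<forall>v \<in> carrier_vec nc. A *\<^sub>v v = 0\<^sub>v n \<longrightarrow> v = 0\<^sub>v nc"
  have unit: "A *\<^sub>v unit_vec nc k = col A k" if "k < nc" for k
    using A that by (intro eq_vecI) auto
  \<comment> \<open>Equal columns at \<open>i\<close> and \<open>j\<close> would put the difference
    of two unit vectors into the kernel.\<close>
  have distinct: "distinct (cols A)"
    unfolding distinct_conv_nth
  proof (intro allI impI notI)
    fix i j assume ij: "i < length (cols A)" "j < length (cols A)" "i \<noteq> j" "cols A ! i = cols A ! j"
    then have *: "i < nc" "j < nc" "col A i = col A j"
      using A by auto
    then have "A *\<^sub>v (unit_vec nc i - unit_vec nc j) = 0\<^sub>v n"
      using A by (simp add: mult_minus_distrib_mat_vec[OF A] unit)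
    with kernel have "unit_vec nc i - unit_vec nc j = (0\<^sub>v nc :: 'a vec)"
      by simp
    then have "(unit_vec nc i - unit_vec nc j) $ i = (0\<^sub>v nc :: 'a vec) $ i"
      by (rule arg_cong)
    with * ij show False
      by simp
  qed
  moreover have "lin_indpt (set (cols A))"
    using lin_depE[OF A _ distinct] kernel by metis
  ultimately show "rank A = nc"
    by (rule lin_indpt_full_rank[OF A])
qed

text \<open>\<open>pick J\<close> translates positions in a submatrix into original indices. It is
  strictly increasing, hence injective, and it is onto by counting.\<close>

lemma bij_betw_pick:
  assumes "finite J"
  shows "bij_betw (pick J) {..<card J} J"
proof -
  have "inj_on (pick J) {..<card J}"
    by (rule linorder_inj_onI) (auto dest: pick_mono_le[rotated] simp: not_less)
  moreover from this have "pick J ` {..<card J} = J"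
    using assms by (intro card_subset_eq) (auto simp: pick_in_set_le card_image)
  ultimately show ?thesis
    by (simp add: bij_betw_def)
qed

text \<open>By \<open>card J \<le> card I\<close>, maximal rank means full column rank, that is, a
  trivial kernel. Reindexing along \<open>pick\<close> turns kernel vectors into functions on
  \<open>J\<close>.\<close>

lemma has_maximal_rank_submatrix_iff:
  assumes U: "U \<in> carrier_mat n r" and I: "I \<subseteq> {..<n}" and J: "J \<subseteq> {..<r}"
    and le: "card J \<le> card I"
  shows "has_maximal_rank (submatrix U I J) \<longleftrightarrow>
    (\<forall>d. (\<forall>j \<in> I. (\<Sum>i \<in> J. d i * U $$ (j, i)) = 0) \<longrightarrow> (\<forall>i \<in> J. d i = 0))"
proof -
  let ?M = "submatrix U I J"
  have sets: "{i. i < dim_row U \<and> i \<in> I} = I" "{i. i < dim_col U \<and> i \<in> J} = J"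
    using U I J by auto
  have fin: "finite I" "finite J"
    using I J finite_subset by blast+
  have M: "?M \<in> carrier_mat (card I) (card J)"
    by (rule carrier_matI) (simp_all add: dim_submatrix sets)
  have pickI: "bij_betw (pick I) {..<card I} I" and pickJ: "bij_betw (pick J) {..<card J} J"
    using fin by (auto intro: bij_betw_pick)
  have product: "(?M *\<^sub>v vec (card J) (\<lambda>b. d (pick J b))) $ a =
      (\<Sum>i \<in> J. d i * U $$ (pick I a, i))" if "a < card I" for a d
  proof -
    have "(?M *\<^sub>v vec (card J) (\<lambda>b. d (pick J b))) $ a =
        (\<Sum>b < card J. d (pick J b) * U $$ (pick I a, pick J b))"
      using that M by (simp add: scalar_prod_def atLeast0LessThan submatrix_index sets mult.commute)
    also have "\<dots> = (\<Sum>i \<in> J. d i * U $$ (pick I a, i))"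
      by (rule sum.reindex_bij_betw[OF pickJ])
    finally show ?thesis .
  qed
  have kernel: "?M *\<^sub>v vec (card J) (\<lambda>b. d (pick J b)) = 0\<^sub>v (card I) \<longleftrightarrow>
      (\<forall>j \<in> I. (\<Sum>i \<in> J. d i * U $$ (j, i)) = 0)" for d
  proof -
    have "?M *\<^sub>v vec (card J) (\<lambda>b. d (pick J b)) = 0\<^sub>v (card I) \<longleftrightarrow>
        (\<forall>a \<in> {..<card I}. (\<Sum>i \<in> J. d i * U $$ (pick I a, i)) = 0)"
      using M by (auto simp: vec_eq_iff product simp del: index_mult_mat_vec)
    also have "\<dots> \<longleftrightarrow> (\<forall>j \<in> pick I ` {..<card I}. (\<Sum>i \<in> J. d i * U $$ (j, i)) = 0)"
      by simp
    finally show ?thesis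
      by (simp only: bij_betw_imp_surj_on[OF pickI])
  qed
  have zero: "vec (card J) (\<lambda>b. d (pick J b)) = 0\<^sub>v (card J) \<longleftrightarrow> (\<forall>i \<in> J. d i = 0)" for d
  proof -
    have "vec (card J) (\<lambda>b. d (pick J b)) = 0\<^sub>v (card J) \<longleftrightarrow> (\<forall>i \<in> pick J ` {..<card J}. d i = 0)"
      by (auto simp: vec_eq_iff)
    then show ?thesis
      by (simp only: bij_betw_imp_surj_on[OF pickJ])
  qed
  \<comment> \<open>Inverting \<open>pick J\<close> shows that every vector comes from such a
    function, so quantifying over \<open>d\<close> is as good as quantifying over
    \<open>v\<close>.\<close>
  have vec: "\<exists>d. v = vec (card J) (\<lambda>b. d (pick J b))" if "v \<in> carrier_vec (card J)" for v
  proof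
    show "v = vec (card J) (\<lambda>b. v $ the_inv_into {..<card J} (pick J) (pick J b))"
      using that pickJ by (auto simp: bij_betw_def the_inv_into_f_f)
  qed
  have "has_maximal_rank ?M \<longleftrightarrow> vec_space.rank (card I) ?M = card J"
    using M le by (simp add: has_maximal_rank_def)
  also have "\<dots> \<longleftrightarrow>
      (\<forall>v \<in> carrier_vec (card J). ?M *\<^sub>v v = 0\<^sub>v (card I) \<longrightarrow> v = 0\<^sub>v (card J))"
    by (rule vec_space.rank_eq_dim_col_iff[OF M])
  also have "\<dots> \<longleftrightarrow> (\<forall>d. ?M *\<^sub>v vec (card J) (\<lambda>b. d (pick J b)) = 0\<^sub>v (card I) \<longrightarrow>
      vec (card J) (\<lambda>b. d (pick J b)) = 0\<^sub>v (card J))"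
    using vec by (metis vec_carrier)
  finally show ?thesis
    by (simp only: kernel zero)
qed

section \<open>Matching families of size \<open>s\<close> with submatrices of
  \<open>U\<close>\<close>

theorem proposition4p10:
  fixes U :: "'a::field mat" and n r s :: nat
  assumes "infinite (UNIV :: 'a set)"
    and "U \<in> carrier_mat n r"
    and "\<exists>c. is_star_configuration_ideal n (forms U) (n + r) c
           (star_ideal (polynomial_ring n) (forms U) (n + r) c)"
    and "2 \<le> s" and "s \<le> n"
  shows "(\<forall>S \<subseteq> {..<n + r}. card S = s \<longrightarrow> regular_subfamily (polynomial_ring n) (forms U) S)
    \<longleftrightarrow>
    (\<forall>h. 1 \<le> h \<and> h \<le> min r s \<longrightarrow>
      (\<forall>I J. I \<subseteq> {..<n} \<and> card I = h + n - s \<and> J \<subseteq> {..<r} \<and> card J = h \<longrightarrow>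
        has_maximal_rank (submatrix U I J)))"
proof -
  \<comment> \<open>The rows in \<open>I\<close> belong to the variables missing from the family,
    hence the complement.\<close>
  have key: "regular_subfamily (polynomial_ring n) (forms U) (({..<n} - I) \<union> (+) n ` J) \<longleftrightarrow>
      has_maximal_rank (submatrix U I J)"
    if "I \<subseteq> {..<n}" "J \<subseteq> {..<r}" "card J \<le> card I" for I J
  proof -
    have "{..<n} - ({..<n} - I) = I" and "finite J"
      using that finite_subset by blast+
    then show ?thesis
      using regular_subfamily_forms_iff[OF assms(2), of "{..<n} - I" J]
        has_maximal_rank_submatrix_iff[OF assms(2) that] by simp
  qed
  have card_family: "card (({..<n} - I) \<union> (+) n ` J) = n - card I + card J"
    if "I \<subseteq> {..<n}" "J \<subseteq> {..<r}" for I J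
  proof -
    have "finite I" "finite J"
      using that finite_subset by blast+
    then show ?thesis
      using that by (subst card_Un_disjoint) (auto simp: card_image card_Diff_subset)
  qed
  show ?thesis
  proof (intro iffI allI impI)
    fix h I J
    assume reg: "\<forall>S \<subseteq> {..<n + r}. card S = s \<longrightarrow> regular_subfamily (polynomial_ring n) (forms U) S"
      and h: "1 \<le> h \<and> h \<le> min r s"
      and IJ: "I \<subseteq> {..<n} \<and> card I = h + n - s \<and> J \<subseteq> {..<r} \<and> card J = h"
    let ?S = "({..<n} - I) \<union> (+) n ` J"
    have "?S \<subseteq> {..<n + r}"
      using IJ by auto
    \<comment> \<open>The count is n - (h + n - s) + h = s, where h \<le> s and s \<le> n keep the
      natural subtractions exact.\<close>
    moreover have "card ?S = s"
      using card_family[of I J] IJ h assms(5) by auto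
    ultimately have "regular_subfamily (polynomial_ring n) (forms U) ?S"
      using reg by blast
    then show "has_maximal_rank (submatrix U I J)"
      using key[of I J] IJ assms(5) by simp
  next
    fix S
    assume rank: "\<forall>h. 1 \<le> h \<and> h \<le> min r s \<longrightarrow>
        (\<forall>I J. I \<subseteq> {..<n} \<and> card I = h + n - s \<and> J \<subseteq> {..<r} \<and> card J = h \<longrightarrow>
          has_maximal_rank (submatrix U I J))"
      and S: "S \<subseteq> {..<n + r}" and card: "card S = s"
    \<comment> \<open>Every \<open>S\<close> arises in this way: \<open>I\<close> consists of the
      variables absent from it, \<open>J\<close> of the indices of the forms L_i present in
      it.\<close>
    define I J where "I = {..<n} - S" and "J = {i. n + i \<in> S}"
    have I: "I \<subseteq> {..<n}" and J: "J \<subseteq> {..<r}"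
      using S by (auto simp: I_def J_def)
    then have finJ: "finite J"
      using finite_subset by blast
    have S_eq: "S = ({..<n} - I) \<union> (+) n ` J"
    proof (rule subset_antisym; rule subsetI)
      fix i assume "i \<in> S"
      then show "i \<in> ({..<n} - I) \<union> (+) n ` J"
        by (cases "i < n") (auto simp: I_def J_def image_iff intro!: exI[of _ "i - n"])
    qed (auto simp: I_def J_def)
    have cards: "n - card I + card J = s" "card I \<le> n" "card J \<le> r"
      using card_family[OF I J] card S_eq card_mono[OF _ I] card_mono[OF _ J] by auto
    show "regular_subfamily (polynomial_ring n) (forms U) S"
    \<comment> \<open>The rank condition starts at \<open>h = 1\<close>. For \<open>h = 0\<close>
      the family consists of variables only, and the criterion of
      \<open>regular_subfamily_forms_iff\<close> holds trivially.\<close>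
    proof (cases "card J = 0")
      case True
      with finJ have "J = {}"
        by simp
      then have "regular_subfamily (polynomial_ring n) (forms U) (({..<n} - I) \<union> (+) n ` {})"
        using regular_subfamily_forms_iff[OF assms(2), of "{..<n} - I" "{}"] by simp
      with \<open>J = {}\<close> S_eq show ?thesis
        by simp
    next
      case False
      \<comment> \<open>Solving the cardinality equation gives card I = card J + n - s and card J
        \<le> s, so \<open>h = card J\<close> is admissible.\<close>
      with cards have "has_maximal_rank (submatrix U I J)"
        using I J assms(5) by (intro rank[rule_format, of "card J"]) auto
      then show ?thesis
        using key[OF I J] S_eq cards assms(5) by simp
    qed
  qed
qed

end
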